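(* Let $q$ be an odd prime power. The number of periodic 2-sets of degree 2 over the finite field $\mathbf F_q$ with $q$ elements is at most $(q-1)^2(q-3)/8$.
   Context: For monic irreducible polynomials $f,g$ over $K=\mathbf F_q$, $f\wedge g$ denotes the minimal polynomial over $K$ of $f(\alpha)$, where $\alpha$ is a root of $g$ (independent of the choice of root). The self-image of a set $S$ of monic irreducible polynomials over $K$ is $\mathcal F(S)=\{f\wedge g : f,g\in S,\ f\neq g\}$; in particular, $\mathcal F(\{f,g\})=\{f\wedge g,\,g\wedge f\}$ for $f\ne g$. A 2-set of degree 2 is an unordered set $\{f,g\}$ of two distinct monic irreducible quadratic polynomials over $K$; it is periodic if $\mathcal F^t(\{f,g\})=\{f,g\}$ for some integer $t\geq1$, where $\mathcal F^t$ is the $t$-th iterate of $\mathcal F$. *)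

theory Defs
  imports "HOL-Algebra.Algebraic_Closure_Type"
begin

text \<open>
  The ground field is a type of class \<open>field\<close>. Roots are taken in its algebraic
  closure \<^typ>\<open>'a alg_closure\<close>, into which it embeds via \<^const>\<open>to_ac\<close>.
\<close>

definition eval_ac :: "'a::field poly \<Rightarrow> 'a alg_closure \<Rightarrow> 'a alg_closure" where
  "eval_ac p x = poly (map_poly to_ac p) x"

definition is_min_poly :: "'a::field poly \<Rightarrow> 'a alg_closure \<Rightarrow> bool" where
  "is_min_poly p x \<longleftrightarrow> Polynomial.lead_coeff p = 1 \<and> eval_ac p x = 0 \<and>
     (\<forall>r. r \<noteq> 0 \<and> eval_ac r x = 0 \<longrightarrow> Polynomial.degree p \<le> Polynomial.degree r)"

definition min_poly :: "'a::field alg_closure \<Rightarrow> 'a poly" where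
  "min_poly x = (THE p. is_min_poly p x)"

text \<open>
  The root of \<open>g\<close> is picked by \<open>SOME\<close>; lemma \<open>wedge_eq\<close> below shows that every root
  gives the same result when \<open>g\<close> is monic and irreducible.
\<close>

definition wedge :: "'a::field poly \<Rightarrow> 'a poly \<Rightarrow> 'a poly" where
  "wedge f g = min_poly (eval_ac f (SOME \<alpha>. eval_ac g \<alpha> = 0))"

definition self_image :: "'a::field poly set \<Rightarrow> 'a poly set" where
  "self_image S = {wedge f g | f g. f \<in> S \<and> g \<in> S \<and> f \<noteq> g}"

definition two_set_deg2 :: "'a::field poly set \<Rightarrow> bool" where
  "two_set_deg2 S \<longleftrightarrow> card S = 2 \<and>
     (\<forall>f\<in>S. Polynomial.lead_coeff f = 1 \<and> Factorial_Ring.irreducible f \<and> Polynomial.degree f = 2)"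

definition periodic :: "'a::field poly set \<Rightarrow> bool" where
  "periodic S \<longleftrightarrow> (\<exists>t\<ge>1. (self_image ^^ t) S = S)"


lemma eval_ac_add: "eval_ac (p + r) x = eval_ac p x + eval_ac r x"
proof -
  have "map_poly to_ac (p + r) = map_poly to_ac p + map_poly to_ac r"
    by (rule poly_eqI) (simp add: coeff_map_poly)
  then show ?thesis by (simp add: eval_ac_def)
qed

lemma eval_ac_diff: "eval_ac (p - r) x = eval_ac p x - eval_ac r x"
  using eval_ac_add[of "p - r" r x] by simp

lemma eval_ac_mult: "eval_ac (p * r) x = eval_ac p x * eval_ac r x"
proof -
  have "map_poly to_ac (p * r) = map_poly to_ac p * map_poly to_ac r"
    by (rule poly_eqI) (simp add: coeff_map_poly coeff_mult to_ac_sum)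
  then show ?thesis by (simp add: eval_ac_def)
qed

lemma eval_ac_const [simp]: "eval_ac [:c:] x = to_ac c"
  by (simp add: eval_ac_def map_poly_pCons)

lemma eval_ac_0 [simp]: "eval_ac 0 x = 0"
  by (simp add: eval_ac_def)

lemma eval_ac_pcompose: "eval_ac (pcompose p f) x = eval_ac p (eval_ac f x)"
proof (induction p)
  case (pCons a p)
  have "eval_ac (pCons a p) y = to_ac a + y * eval_ac p y" for y
    by (simp add: eval_ac_def map_poly_pCons)
  with pCons show ?case by (simp add: pcompose_pCons eval_ac_add eval_ac_mult)
qed simp

lemma is_min_poly_exists: "\<exists>p. is_min_poly p (x :: 'a::field alg_closure)"
proof -
  define P where "P = (\<lambda>p :: 'a poly. p \<noteq> 0 \<and> eval_ac p x = 0)"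
  obtain p0 where "P p0"
    using alg_closure_algebraic[of x] unfolding P_def eval_ac_def by metis
  then obtain p where p: "P p" "\<And>r. P r \<Longrightarrow> Polynomial.degree p \<le> Polynomial.degree r"
    using ex_has_least_nat[of P p0 Polynomial.degree] by metis
  define c where "c = Polynomial.lead_coeff p"
  have "c \<noteq> 0" using p(1) by (simp add: c_def P_def)
  have "eval_ac ([:inverse c:] * p) x = 0"
    using p(1) by (simp only: eval_ac_mult P_def) simp
  then have "is_min_poly (smult (inverse c) p) x"
    using p \<open>c \<noteq> 0\<close> by (auto simp: is_min_poly_def P_def c_def)
  then show ?thesis ..
qed

lemma is_min_poly_dvd:
  assumes "is_min_poly m x" shows "m dvd p \<longleftrightarrow> eval_ac p x = 0"
proof
  assume "eval_ac p x = 0"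
  have m: "m \<noteq> 0" "eval_ac m x = 0" using assms by (auto simp: is_min_poly_def)
  have "eval_ac (p mod m) x = eval_ac p x - eval_ac (p div m * m) x"
    by (simp flip: eval_ac_diff minus_div_mult_eq_mod)
  also have "\<dots> = 0" using \<open>eval_ac p x = 0\<close> m by (simp add: eval_ac_mult)
  finally have "p mod m = 0"
    using assms degree_mod_less[OF m(1), of p] unfolding is_min_poly_def by (meson not_less)
  then show "m dvd p" by (simp add: dvd_eq_mod_eq_0)
qed (use assms in \<open>auto simp: is_min_poly_def eval_ac_mult\<close>)

lemma monic_dvd_antisym:
  fixes p r :: "'a::field poly"
  assumes "Polynomial.lead_coeff p = 1" "Polynomial.lead_coeff r = 1" "p dvd r" "r dvd p"
  shows "p = r"
proof -
  obtain k where k: "r = p * k" using assms(3) by (elim dvdE)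
  have "p \<noteq> 0" "r \<noteq> 0" using assms(1,2) by auto
  then have "Polynomial.degree p = Polynomial.degree r"
    using assms(3,4) by (intro antisym dvd_imp_degree_le)
  moreover have "k \<noteq> 0" using k \<open>r \<noteq> 0\<close> by auto
  ultimately have "Polynomial.degree k = 0"
    using k \<open>p \<noteq> 0\<close> by (simp add: degree_mult_eq)
  then obtain c where c: "k = [:c:]" by (rule degree_eq_zeroE)
  then have "c = 1" using k assms(1,2) by (simp split: if_splits)
  with k c show ?thesis by simp
qed

lemma is_min_poly_unique: "is_min_poly p x \<Longrightarrow> is_min_poly r x \<Longrightarrow> p = r"
  by (rule monic_dvd_antisym) (auto simp: is_min_poly_dvd, auto simp: is_min_poly_def)

lemma is_min_poly_min_poly: "is_min_poly (min_poly x) x"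
  unfolding min_poly_def
  by (rule theI') (use is_min_poly_exists is_min_poly_unique in blast)

lemma is_min_poly_irreducible:
  fixes g :: "'a::field poly"
  assumes "Polynomial.lead_coeff g = 1" "Factorial_Ring.irreducible g" "eval_ac g \<alpha> = 0"
  shows "is_min_poly g \<alpha>"
proof -
  obtain m where m: "is_min_poly m \<alpha>" using is_min_poly_exists by blast
  have "m dvd g" using m assms(3) by (simp add: is_min_poly_dvd)
  moreover have "\<not> is_unit m"
  proof
    assume "is_unit m"
    then have "m dvd 1" .
    then have "eval_ac 1 \<alpha> = 0" using is_min_poly_dvd[OF m] by blast
    then show False by (simp add: eval_ac_def)
  qed
  ultimately have "g dvd m" using assms(2) by (metis irreducibleD')
  with \<open>m dvd g\<close> have "m = g"
    using m assms(1) by (intro monic_dvd_antisym) (auto simp: is_min_poly_def)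
  with m show ?thesis by simp
qed

lemma wedge_eq:
  fixes f g :: "'a::field poly"
  assumes g: "Polynomial.lead_coeff g = 1" "Factorial_Ring.irreducible g" and \<alpha>: "eval_ac g \<alpha> = 0"
  shows "wedge f g = min_poly (eval_ac f \<alpha>)"
proof -
  define \<beta> where "\<beta> = (SOME \<alpha>. eval_ac g \<alpha> = 0)"
  have \<beta>: "eval_ac g \<beta> = 0" unfolding \<beta>_def using \<alpha> by (rule someI)
  have "eval_ac p (eval_ac f \<beta>) = 0 \<longleftrightarrow> eval_ac p (eval_ac f \<alpha>) = 0" for p
    using is_min_poly_dvd[OF is_min_poly_irreducible[OF g \<alpha>], of "pcompose p f"]
      is_min_poly_dvd[OF is_min_poly_irreducible[OF g \<beta>], of "pcompose p f"]
    by (simp add: eval_ac_pcompose)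
  then have "is_min_poly p (eval_ac f \<beta>) \<longleftrightarrow> is_min_poly p (eval_ac f \<alpha>)" for p
    unfolding is_min_poly_def by blast
  then show ?thesis by (simp add: wedge_def min_poly_def \<beta>_def)
qed

text \<open>
  \<^const>\<open>card\<close> is \<open>0\<close> on infinite sets; the following excludes that reading of a count
  of 2-sets over a finite field.
\<close>

lemma finite_two_sets: "finite {S :: 'a::{field,finite} poly set. two_set_deg2 S}"
proof (rule finite_subset)
  show "{S :: 'a poly set. two_set_deg2 S} \<subseteq> Pow (Poly ` {xs. set xs \<subseteq> UNIV \<and> length xs = 3})"
  proof clarify
    fix S and f :: "'a poly" assume "two_set_deg2 S" "f \<in> S"
    then have "Polynomial.degree f = 2" by (simp add: two_set_deg2_def)
    moreover then have "f \<noteq> 0" by auto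
    ultimately have "f = Poly (coeffs f)" "length (coeffs f) = 3"
      by (simp_all add: length_coeffs_degree)
    then show "f \<in> Poly ` {xs. set xs \<subseteq> UNIV \<and> length xs = 3}" by blast
  qed
  show "finite (Pow (Poly ` {xs :: 'a list. set xs \<subseteq> UNIV \<and> length xs = 3}))"
    by (intro finite_Pow_iff[THEN iffD2] finite_imageI finite_lists_length_eq) simp
qed

end

theory Submission
  imports Defs
begin

text \<open>
  For distinct irreducible \<open>f = x\<^sup>2 + a x + b\<close> and \<open>g = x\<^sup>2 + c x + d\<close> with discriminants \<open>A\<close>, \<open>B\<close>,
  put \<open>s = a - c\<close>. At a root \<open>\<alpha>\<close> of \<open>g\<close>, \<open>f\<close> takes the value \<open>s \<alpha> + (b - d)\<close>, so if \<open>s = 0\<close> the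
  self-image consists of linear polynomials, and this persists under iteration. If \<open>s \<noteq> 0\<close>, the
  ordered pair \<open>(f \<and> g, g \<and> f)\<close> has discriminants \<open>s\<^sup>2 B\<close>, \<open>s\<^sup>2 A\<close>, its linear coefficients differ
  by \<open>A - B\<close> and add up to \<open>- s\<^sup>2\<close>. Hence a periodic 2-set has \<open>s \<noteq> 0\<close> and \<open>A \<noteq> B\<close>, and \<open>(s, A, B)\<close>
  determines its self-image, thus the 2-set itself since the self-image map is injective on
  periodic points. The ordered pairs therefore inject into the triples with \<open>s \<noteq> 0\<close> and \<open>A \<noteq> B\<close>
  nonsquares, of which there are \<open>(q - 1) \<cdot> (q - 1)/2 \<cdot> (q - 3)/2\<close>, and each 2-set comes from two
  ordered pairs.
\<close>

section \<open>Monic polynomials of degree one and two\<close>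

definition quad_discr :: "'a::field poly \<Rightarrow> 'a" where
  "quad_discr f = (Polynomial.coeff f 1)\<^sup>2 - 4 * Polynomial.coeff f 0"

text \<open>A class closed under \<open>self_image\<close> that contains no 2-set of degree 2. The
  empty set belongs to it, which covers orbits that collapse to a single polynomial.\<close>

definition all_linear :: "'a::field poly set \<Rightarrow> bool" where
  "all_linear S \<longleftrightarrow> (\<forall>f\<in>S. Polynomial.lead_coeff f = 1 \<and> Polynomial.degree f = 1)"

lemma monic_quadratic_eq:
  fixes f :: "'a::field poly"
  assumes "Polynomial.lead_coeff f = 1" "Polynomial.degree f = 2"
  shows "f = [:Polynomial.coeff f 0, Polynomial.coeff f 1, 1:]"
proof (rule poly_eqI)
  fix n :: nat
  consider "n = 0" | "n = 1" | "n = 2" | "n > 2" by linarith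
  then show "Polynomial.coeff f n = Polynomial.coeff [:Polynomial.coeff f 0, Polynomial.coeff f 1, 1:] n"
    using assms by cases (auto simp: coeff_pCons coeff_eq_0 numeral_2_eq_2 split: nat.splits)
qed

lemma monic_linear_eq:
  fixes f :: "'a::field poly"
  assumes "Polynomial.lead_coeff f = 1" "Polynomial.degree f = 1"
  shows "f = [:Polynomial.coeff f 0, 1:]"
  using assms by (intro poly_eqI) (auto simp: coeff_pCons coeff_eq_0 split: nat.splits)

text \<open>With a the linear coefficient, a square root y of the discriminant would split f as (x +
  (a + y)/2)(x + (a - y)/2).\<close>

lemma quad_discr_not_square:
  fixes f :: "'a::field poly"
  assumes f: "Polynomial.lead_coeff f = 1" "Polynomial.degree f = 2"
    "Factorial_Ring.irreducible f" and 2: "(2::'a) \<noteq> 0"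
  shows "quad_discr f \<noteq> y\<^sup>2"
proof
  assume y: "quad_discr f = y\<^sup>2"
  define a b where "a = Polynomial.coeff f 1" and "b = Polynomial.coeff f 0"
  have "(4::'a) \<noteq> 0" using 2 by (metis mult_2 mult_eq_0_iff numeral_Bit0)
  define u v where "u = (a + y) / 2" and "v = (a - y) / 2"
  have "4 * b = a\<^sup>2 - y\<^sup>2" using y by (simp add: quad_discr_def a_def b_def algebra_simps)
  then have b: "b = u * v"
    using 2 \<open>4 \<noteq> 0\<close> by (simp add: u_def v_def field_simps power2_eq_square)
  have a: "a = u + v"
    using 2 by (simp add: u_def v_def flip: add_divide_distrib mult_2)
  have "f = [:b, a, 1:]" using monic_quadratic_eq[OF f(1,2)] by (simp only: a_def b_def)
  also have "\<dots> = [:u, 1:] * [:v, 1:]" by (simp add: a b add.commute)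
  finally have "f = [:u, 1:] * [:v, 1:]" .
  then have "is_unit [:u, 1:] \<or> is_unit [:v, 1:]"
    using f(3) irreducibleD by blast
  then show False by (auto simp: is_unit_poly_iff)
qed

section \<open>Minimal polynomials of values at roots\<close>

lemma eval_ac_has_root:
  fixes g :: "'a::field poly"
  assumes "Polynomial.degree g > 0"
  shows "\<exists>\<alpha>. eval_ac g \<alpha> = 0"
proof -
  have "Polynomial.degree (map_poly (to_ac :: 'a \<Rightarrow> _) g) = Polynomial.degree g"
    by (rule degree_map_poly) auto
  then show ?thesis
    unfolding eval_ac_def using assms by (metis alg_closed_imp_poly_has_root)
qed

lemma min_poly_eq: "is_min_poly p x \<Longrightarrow> min_poly x = p"
  using is_min_poly_min_poly is_min_poly_unique by blast

lemma min_poly_to_ac: "min_poly (to_ac c) = [:- c, 1:]"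
proof (rule min_poly_eq)
  have "Polynomial.degree r \<ge> 1" if "r \<noteq> 0" "eval_ac r (to_ac c) = 0" for r
  proof (rule ccontr)
    assume "\<not> Polynomial.degree r \<ge> 1"
    then obtain d where "r = [:d:]" by (metis degree_eq_zeroE less_one not_le)
    with that show False by simp
  qed
  then show "is_min_poly [:- c, 1:] (to_ac c)"
    by (simp add: is_min_poly_def eval_ac_def map_poly_pCons)
qed

text \<open>A value in the ground field has a linear minimal polynomial. The assumption ranges over
  all roots because \<open>wedge\<close> evaluates at an unspecified one.\<close>

lemma wedge_linear:
  fixes f g :: "'a::field poly"
  assumes "Polynomial.degree g > 0" and "\<And>\<alpha>. eval_ac g \<alpha> = 0 \<Longrightarrow> \<exists>c. eval_ac f \<alpha> = to_ac c"
  shows "Polynomial.lead_coeff (wedge f g) = 1 \<and> Polynomial.degree (wedge f g) = 1"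
proof -
  have "eval_ac g (SOME \<alpha>. eval_ac g \<alpha> = 0) = 0"
    using eval_ac_has_root[OF assms(1)] by (rule someI_ex)
  then obtain c where "eval_ac f (SOME \<alpha>. eval_ac g \<alpha> = 0) = to_ac c" using assms(2) by blast
  then show ?thesis by (simp add: wedge_def min_poly_to_ac)
qed

lemma eval_ac_to_ac: "eval_ac f (to_ac r) = to_ac (poly f r)"
  by (induction f) (simp_all add: eval_ac_def map_poly_pCons)

text \<open>The root of a monic linear polynomial lies in the ground field, hence so does the value
  of any polynomial there.\<close>

lemma all_linear_self_image:
  assumes "all_linear S"
  shows "all_linear (self_image S)"
proof -
  have "Polynomial.lead_coeff (wedge f g) = 1 \<and> Polynomial.degree (wedge f g) = 1" if "g \<in> S" for f g
  proof (rule wedge_linear)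
    have g: "Polynomial.lead_coeff g = 1" "Polynomial.degree g = 1"
      using assms that by (auto simp: all_linear_def)
    show "Polynomial.degree g > 0" using g by simp
    fix \<alpha> assume "eval_ac g \<alpha> = 0"
    then have "eval_ac [:Polynomial.coeff g 0, 1:] \<alpha> = 0" using monic_linear_eq[OF g] by metis
    then have "\<alpha> = to_ac (- Polynomial.coeff g 0)"
      by (simp add: eval_ac_def map_poly_pCons eq_neg_iff_add_eq_0 add.commute)
    then show "\<exists>c. eval_ac f \<alpha> = to_ac c" using eval_ac_to_ac by metis
  qed
  then show ?thesis by (auto simp: all_linear_def self_image_def)
qed

lemma all_linear_self_image_iter: "all_linear S \<Longrightarrow> all_linear ((self_image ^^ n) S)"
  by (induction n) (auto simp: all_linear_self_image)

text \<open>Here f - g is constant, so f takes a ground field value at each root of g.\<close>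

lemma wedge_quadratic_linear:
  fixes f g :: "'a::field poly"
  assumes f: "Polynomial.lead_coeff f = 1" "Polynomial.degree f = 2"
    and g: "Polynomial.lead_coeff g = 1" "Polynomial.degree g = 2"
    and eq: "Polynomial.coeff f 1 = Polynomial.coeff g 1"
  shows "Polynomial.lead_coeff (wedge f g) = 1 \<and> Polynomial.degree (wedge f g) = 1"
proof (rule wedge_linear)
  fix \<alpha> assume 0: "eval_ac g \<alpha> = 0"
  have "f = g + [:Polynomial.coeff f 0 - Polynomial.coeff g 0:]"
    using arg_cong2[OF monic_quadratic_eq[OF f] monic_quadratic_eq[OF g], of "(-)"] eq
    by (simp add: algebra_simps)
  then have "eval_ac f \<alpha> = eval_ac g \<alpha> + to_ac (Polynomial.coeff f 0 - Polynomial.coeff g 0)"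
    by (metis eval_ac_add eval_ac_const)
  with 0 show "\<exists>c. eval_ac f \<alpha> = to_ac c" by (metis add_0)
qed (use g in simp)

text \<open>The monic quadratic with linear coefficient (A - B - s^2)/2 and discriminant s^2 B, in
  terms of the parameters that will count the periodic sets. Exchanging f and g turns (s, A, B) into
  (-s, B, A).\<close>

definition wedge_quad :: "'a::field \<Rightarrow> 'a \<Rightarrow> 'a \<Rightarrow> 'a poly" where
  "wedge_quad s A B = [:(((A - B - s\<^sup>2) / 2)\<^sup>2 - s\<^sup>2 * B) / 4, (A - B - s\<^sup>2) / 2, 1:]"

text \<open>At a root \<alpha> of g, f agrees with the linear polynomial l = f - g. Since h(l(x)) =
  s^2 g(x), h vanishes at l(\<alpha>). It is minimal there: if r vanishes at l(\<alpha>), then g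
  divides the nonzero polynomial r(l(x)), whose degree is that of r.\<close>

lemma wedge_eq_wedge_quad:
  fixes f g :: "'a::field poly"
  assumes f: "Polynomial.lead_coeff f = 1" "Polynomial.degree f = 2"
    and g: "Polynomial.lead_coeff g = 1" "Polynomial.degree g = 2" "Factorial_Ring.irreducible g"
    and 2: "(2::'a) \<noteq> 0" and s: "Polynomial.coeff f 1 \<noteq> Polynomial.coeff g 1"
  shows "wedge f g = wedge_quad (Polynomial.coeff f 1 - Polynomial.coeff g 1) (quad_discr f) (quad_discr g)"
proof -
  define a b where "a = Polynomial.coeff f 1" and "b = Polynomial.coeff f 0"
  define c d where "c = Polynomial.coeff g 1" and "d = Polynomial.coeff g 0"
  define s t where "s = a - c" and "t = b - d"
  define h where "h = wedge_quad s (quad_discr f) (quad_discr g)"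
  define l where "l = [:t, s:]"
  have 4: "(4::'a) \<noteq> 0" using 2 by (metis mult_2 mult_eq_0_iff numeral_Bit0)
  have "s \<noteq> 0" using s by (simp add: s_def a_def c_def)
  have f_eq: "f = [:b, a, 1:]" and g_eq: "g = [:d, c, 1:]"
    using monic_quadratic_eq[OF f] monic_quadratic_eq[OF g(1,2)] by (simp_all only: a_def b_def c_def d_def)
  have A: "quad_discr f = a\<^sup>2 - 4 * b" and B: "quad_discr g = c\<^sup>2 - 4 * d"
    by (simp_all add: quad_discr_def a_def b_def c_def d_def)
  \<comment> \<open>The two identities rewrite the coefficients of h as minus the trace and the norm
    of t + s \<alpha>.\<close>
  have "quad_discr f - quad_discr g - s\<^sup>2 = 2 * (s * c - 2 * t)"
    unfolding A B s_def t_def by (simp add: algebra_simps power2_eq_square)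
  then have h1: "(quad_discr f - quad_discr g - s\<^sup>2) / 2 = s * c - 2 * t"
    using 2 by simp
  have "(s * c - 2 * t)\<^sup>2 - s\<^sup>2 * quad_discr g = 4 * (s\<^sup>2 * d + t\<^sup>2 - s * t * c)"
    unfolding B by (simp add: algebra_simps power2_eq_square)
  then have h: "h = [:s\<^sup>2 * d + t\<^sup>2 - s * t * c, s * c - 2 * t, 1:]"
    using 4 by (simp add: h_def wedge_quad_def h1)
  obtain \<alpha> where \<alpha>: "eval_ac g \<alpha> = 0" using eval_ac_has_root[of g] g(2) by auto
  have "f = g + l" by (simp add: f_eq g_eq l_def s_def t_def)
  then have f\<alpha>: "eval_ac f \<alpha> = eval_ac l \<alpha>" using \<alpha> by (simp add: eval_ac_add)
  have comp: "pcompose h l = [:s\<^sup>2:] * g"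
    by (simp add: h l_def g_eq pcompose_pCons algebra_simps power2_eq_square)
  have "is_min_poly h (eval_ac l \<alpha>)"
    unfolding is_min_poly_def
  proof (intro conjI allI impI)
    show "Polynomial.lead_coeff h = 1" by (simp add: h)
    show "eval_ac h (eval_ac l \<alpha>) = 0"
      using \<alpha> by (simp only: comp eval_ac_mult mult_zero_right flip: eval_ac_pcompose)
    fix r :: "'a poly" assume r: "r \<noteq> 0 \<and> eval_ac r (eval_ac l \<alpha>) = 0"
    have l: "Polynomial.degree l = 1" using \<open>s \<noteq> 0\<close> by (simp add: l_def)
    then have "pcompose r l \<noteq> 0" using r pcompose_eq_0[of r l] by auto
    moreover have "g dvd pcompose r l"
      using is_min_poly_dvd[OF is_min_poly_irreducible[OF g(1,3) \<alpha>]] r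
      by (simp add: eval_ac_pcompose)
    ultimately have "Polynomial.degree g \<le> Polynomial.degree (pcompose r l)"
      by (intro dvd_imp_degree_le)
    then show "Polynomial.degree h \<le> Polynomial.degree r"
      using l g(2) by (simp add: h degree_pcompose)
  qed
  then have "wedge f g = h" using wedge_eq[OF g(1,3) \<alpha>] f\<alpha> min_poly_eq by metis
  then show ?thesis by (simp add: h_def s_def a_def c_def)
qed

section \<open>Orbits of periodic 2-sets\<close>

lemma self_image_pair: "f \<noteq> g \<Longrightarrow> self_image {f, g} = {wedge f g, wedge g f}"
  by (auto simp: self_image_def)

lemma funpow_period_mult: "(F ^^ t) x = x \<Longrightarrow> (F ^^ (t * k)) x = x"
  by (induction k) (simp_all add: funpow_add)

lemma periodic_not_all_linear:
  assumes S: "two_set_deg2 S" "periodic S"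
  shows "\<not> all_linear ((self_image ^^ n) S)"
proof
  assume lin: "all_linear ((self_image ^^ n) S)"
  obtain t where t: "t \<ge> 1" "(self_image ^^ t) S = S" using S(2) by (auto simp: periodic_def)
  \<comment> \<open>As t is at least 1, the multiple t * n of the period is at least n, so the orbit
    returns to S after its n-th member.\<close>
  then have "(self_image ^^ (t * n - n)) ((self_image ^^ n) S) = S"
    using funpow_period_mult[OF t(2), of n] by (simp flip: funpow_add[unfolded o_def, THEN fun_cong])
  with lin have "all_linear S" using all_linear_self_image_iter by metis
  with S(1) have "S = {}" by (auto simp: all_linear_def two_set_deg2_def)
  with S(1) show False by (simp add: two_set_deg2_def)
qed

text \<open>Two periodic sets with periods t and u share the period t * u. If they agree after one
  step, they agree after t * u steps, when both have returned.\<close>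

lemma self_image_inj_on_periodic: "inj_on self_image {S. periodic S}"
proof (rule inj_onI, clarify)
  fix S T :: "'a poly set" assume "periodic S" "periodic T" and eq: "self_image S = self_image T"
  then obtain t u where t: "t \<ge> 1" "(self_image ^^ t) S = S" and u: "u \<ge> 1" "(self_image ^^ u) T = T"
    by (auto simp: periodic_def)
  then obtain m where "t * u = Suc m" by (cases "t * u") auto
  then have "(self_image ^^ (t * u)) S = (self_image ^^ (t * u)) T"
    using eq by (simp add: funpow_Suc_right del: funpow.simps)
  then show "S = T"
    using funpow_period_mult[OF t(2), of u] funpow_period_mult[OF u(2), of t]
    by (simp add: mult.commute)
qed

text \<open>Either equality would drive the orbit into \<open>all_linear\<close>: equal linear
  coefficients after one step, equal discriminants after two, through a one-element set and then the
  empty set.\<close>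

lemma periodic_pair_coeffs:
  fixes f g :: "'a::field poly"
  assumes S: "two_set_deg2 {f, g}" "periodic {f, g}" and "f \<noteq> g" and 2: "(2::'a) \<noteq> 0"
  shows "Polynomial.coeff f 1 \<noteq> Polynomial.coeff g 1" "quad_discr f \<noteq> quad_discr g"
proof -
  have f: "Polynomial.lead_coeff f = 1" "Polynomial.degree f = 2" "Factorial_Ring.irreducible f"
    and g: "Polynomial.lead_coeff g = 1" "Polynomial.degree g = 2" "Factorial_Ring.irreducible g"
    using S(1) by (auto simp: two_set_deg2_def)
  show s: "Polynomial.coeff f 1 \<noteq> Polynomial.coeff g 1"
  proof
    assume "Polynomial.coeff f 1 = Polynomial.coeff g 1"
    then have "all_linear (self_image {f, g})"
      using wedge_quadratic_linear[OF f(1,2) g(1,2)] wedge_quadratic_linear[OF g(1,2) f(1,2)] \<open>f \<noteq> g\<close>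
      by (auto simp only: self_image_pair[OF \<open>f \<noteq> g\<close>] all_linear_def)
    then show False using periodic_not_all_linear[OF S, of 1] by simp
  qed
  show "quad_discr f \<noteq> quad_discr g"
  proof
    assume eq: "quad_discr f = quad_discr g"
    define S' where "S' = self_image {f, g}"
    define s where "s = Polynomial.coeff f 1 - Polynomial.coeff g 1"
    \<comment> \<open>For equal discriminants \<open>wedge_quad\<close> depends on s only through
      s^2, so the two wedges coincide.\<close>
    have "wedge f g = wedge_quad s (quad_discr g) (quad_discr g)"
      using wedge_eq_wedge_quad[OF f(1,2) g 2 s] eq by (simp add: s_def)
    moreover have "wedge g f = wedge_quad (- s) (quad_discr g) (quad_discr g)"
      using wedge_eq_wedge_quad[OF g(1,2) f 2 s[symmetric]] eq by (simp add: s_def)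
    ultimately have "h = wedge_quad s (quad_discr g) (quad_discr g)" if "h \<in> S'" for h
      using that by (auto simp: S'_def self_image_pair[OF \<open>f \<noteq> g\<close>] wedge_quad_def)
    then have "self_image S' = {}" by (auto simp: self_image_def)
    then have "all_linear (self_image S')" by (simp add: all_linear_def)
    then show False using periodic_not_all_linear[OF S, of 2] by (simp add: S'_def numeral_2_eq_2)
  qed
qed

section \<open>Counting over a finite field of odd order\<close>

lemma two_neq_0_of_odd_card:
  assumes "odd (card (UNIV :: 'a::{field,finite} set))"
  shows "(2::'a) \<noteq> 0"
proof
  assume 2: "(2::'a) = 0"
  \<comment> \<open>Adding 1 is thus an involution without fixed points, and its orbits partition
    the field into 2-element sets.\<close>
  have x: "x + 1 + 1 = x" for x :: 'a using 2 by (simp add: add.assoc)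
  define P where "P = range (\<lambda>x::'a. {x, x + 1})"
  have "card (\<Union>P) = sum card P"
    by (rule card_Union_disjoint) (auto simp: P_def pairwise_def disjnt_def x)
  also have "\<dots> = (\<Sum>S\<in>P. 2)" by (rule sum.cong) (auto simp: P_def)
  also have "\<Union>P = UNIV" by (auto simp: P_def)
  finally show False using assms by (metis dvd_triv_right sum_constant)
qed

text \<open>Squaring is two-to-one on nonzero elements, with fibres {z, -z}. So half of the nonzero
  elements are squares and the other half are nonsquares.\<close>

lemma card_nonsquares:
  assumes "(2::'a::{field,finite}) \<noteq> 0"
  shows "2 * card {x::'a. \<nexists>y. x = y\<^sup>2} + 1 = card (UNIV :: 'a set)"
proof -
  define Q where "Q = (\<lambda>y::'a. y\<^sup>2) ` (- {0})"
  have "card {y \<in> - {0}. y\<^sup>2 = x} = 2" if "x \<in> Q" for x :: 'a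
  proof -
    obtain z where z: "z \<noteq> 0" "x = z\<^sup>2" using \<open>x \<in> Q\<close> by (auto simp: Q_def)
    then have "{y \<in> - {0}. y\<^sup>2 = x} = {z, - z}" by (auto simp: power2_eq_iff)
    moreover have "z \<noteq> - z" using z assms by (metis eq_neg_iff_add_eq_0 mult_2 mult_eq_0_iff)
    ultimately show ?thesis by simp
  qed
  then have "card (- {0::'a}) = 2 * card Q"
    using sum.group[of "- {0::'a}" Q "\<lambda>y. y\<^sup>2" "\<lambda>_. 1::nat"] by (simp add: Q_def)
  moreover have "card {x::'a. \<nexists>y. x = y\<^sup>2} + card (insert 0 Q) = card (UNIV :: 'a set)"
  proof -
    have "{x::'a. \<nexists>y. x = y\<^sup>2} = - insert 0 Q" by (auto simp: Q_def)
    moreover have "card (insert 0 Q) \<le> card (UNIV :: 'a set)" by (intro card_mono) auto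
    ultimately show ?thesis by (simp add: card_Diff_subset Compl_eq_Diff_UNIV del: card_insert_disjoint)
  qed
  moreover have "card (insert 0 Q) = Suc (card Q)"
  proof (rule card_insert_disjoint)
    show "0 \<notin> Q" by (auto simp: Q_def)
  qed simp
  moreover have "card (- {0::'a}) + 1 = card (UNIV :: 'a set)"
    using card_Suc_Diff1[of UNIV "0::'a"] by (simp add: Compl_eq_Diff_UNIV)
  ultimately show ?thesis by linarith
qed

lemma card_ordered_pairs:
  assumes "finite P" "\<And>S. S \<in> P \<Longrightarrow> card S = 2"
  shows "card {(x, y). {x, y} \<in> P \<and> x \<noteq> y} = 2 * card P"
proof -
  have "{(x, y). {x, y} \<in> P \<and> x \<noteq> y} = (\<Union>S\<in>P. {(x, y). {x, y} = S \<and> x \<noteq> y})" by auto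
  also have "card \<dots> = (\<Sum>S\<in>P. card {(x, y). {x, y} = S \<and> x \<noteq> y})"
  proof (rule card_UN_disjoint)
    show "\<forall>S\<in>P. finite {(x, y). {x, y} = S \<and> x \<noteq> y}"
    proof
      fix S assume "S \<in> P"
      then have "finite (S \<times> S)" using assms(2) by (metis card.infinite finite_SigmaI zero_neq_numeral)
      then show "finite {(x, y). {x, y} = S \<and> x \<noteq> y}" by (rule rev_finite_subset) auto
    qed
  qed (use assms in auto)
  also have "\<dots> = (\<Sum>S\<in>P. 2)"
  proof (rule sum.cong)
    fix S assume "S \<in> P"
    then obtain u v where uv: "S = {u, v}" "u \<noteq> v" using assms(2) by (meson card_2_iff)
    then have "{(x, y). {x, y} = S \<and> x \<noteq> y} = {(u, v), (v, u)}" by (auto simp: doubleton_eq_iff)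
    then show "card {(x, y). {x, y} = S \<and> x \<noteq> y} = 2" using uv by simp
  qed simp
  finally show ?thesis by simp
qed

lemma card_distinct_pairs:
  assumes "finite N"
  shows "card {(A, B). A \<in> N \<and> B \<in> N \<and> A \<noteq> B} = card N * (card N - 1)"
proof -
  have "{(A, B). A \<in> N \<and> B \<in> N \<and> A \<noteq> B} = (SIGMA A:N. N - {A})" by auto
  then show ?thesis using assms by simp
qed

theorem theorem5p5:
  fixes q :: nat
  assumes "card (UNIV :: 'a::{field,finite} set) = q" and "odd q"
  shows "real (card {S :: 'a poly set. two_set_deg2 S \<and> periodic S})
           \<le> (real q - 1)^2 * (real q - 3) / 8"
proof -
  have 2: "(2::'a) \<noteq> 0" using assms two_neq_0_of_odd_card by blast
  define N where "N = {x::'a. \<nexists>y. x = y\<^sup>2}"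
  define P where "P = {S :: 'a poly set. two_set_deg2 S \<and> periodic S}"
  \<comment> \<open>Pairs are ordered because exchanging f and g changes the triple
    \<open>\<phi>\<close>.\<close>
  define O2 where "O2 = {(f, g). {f, g} \<in> P \<and> f \<noteq> g}"
  define \<phi> where "\<phi> = (\<lambda>(f, g :: 'a poly).
    (Polynomial.coeff f 1 - Polynomial.coeff g 1, quad_discr f, quad_discr g))"
  define T where "T = (- {0::'a}) \<times> {(A, B). A \<in> N \<and> B \<in> N \<and> A \<noteq> B}"
  have "finite P" using finite_subset[OF _ finite_two_sets] by (auto simp: P_def)
  then have O2: "card O2 = 2 * card P"
    unfolding O2_def by (intro card_ordered_pairs) (auto simp: P_def two_set_deg2_def)
  have pair: "two_set_deg2 {f, g}" "periodic {f, g}" "f \<noteq> g"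
      "Polynomial.lead_coeff f = 1" "Polynomial.degree f = 2" "Factorial_Ring.irreducible f"
      "Polynomial.lead_coeff g = 1" "Polynomial.degree g = 2" "Factorial_Ring.irreducible g"
    if "(f, g) \<in> O2" for f g
    using that by (auto simp: O2_def P_def two_set_deg2_def)
  have image: "self_image {f, g} = {wedge_quad s A B, wedge_quad (- s) B A}"
    if fg: "(f, g) \<in> O2" and \<phi>: "\<phi> (f, g) = (s, A, B)" for f g s A B
  proof -
    note pair = pair[OF fg]
    have s: "Polynomial.coeff f 1 \<noteq> Polynomial.coeff g 1"
      using periodic_pair_coeffs pair 2 by blast
    show ?thesis
      using \<phi> wedge_eq_wedge_quad[OF pair(4,5,7,8,9) 2 s]
        wedge_eq_wedge_quad[OF pair(7,8,4,5,6) 2 s[symmetric]]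
      by (auto simp: \<phi>_def self_image_pair[OF pair(3)])
  qed
  have "inj_on \<phi> O2"
  proof (rule inj_onI, clarify)
    fix f g f' g' assume fg: "(f, g) \<in> O2" and fg': "(f', g') \<in> O2" and eq: "\<phi> (f, g) = \<phi> (f', g')"
    \<comment> \<open>By \<open>image\<close>, the self-image is a function of the triple
      alone.\<close>
    have "self_image {f, g} = self_image {f', g'}"
      using image[OF fg] image[OF fg'] eq by (metis prod_cases3)
    then have "{f, g} = {f', g'}"
      by (rule inj_onD[OF self_image_inj_on_periodic]) (simp_all add: pair(2) fg fg')
    \<comment> \<open>The pairs could still differ in order, but equal triples would then force f
      and g to have equal discriminants.\<close>
    moreover have "\<not> (f = g' \<and> g = f')"
    proof
      assume "f = g' \<and> g = f'"
      moreover have "quad_discr f = quad_discr f'" using eq by (simp add: \<phi>_def)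
      ultimately have "quad_discr f = quad_discr g" by metis
      then show False using periodic_pair_coeffs(2) pair[OF fg] 2 by blast
    qed
    ultimately show "f = f' \<and> g = g'" by (auto simp: doubleton_eq_iff)
  qed
  moreover have "\<phi> ` O2 \<subseteq> T"
  proof (rule image_subsetI)
    fix x assume "x \<in> O2"
    moreover obtain f g where x: "x = (f, g)" by (cases x)
    ultimately have "(f, g) \<in> O2" by simp
    note pair = pair[OF this]
    show "\<phi> x \<in> T"
      unfolding x using periodic_pair_coeffs[OF pair(1,2,3) 2] quad_discr_not_square[OF pair(4,5,6) 2]
        quad_discr_not_square[OF pair(7,8,9) 2] by (auto simp: \<phi>_def T_def N_def)
  qed
  ultimately have "card O2 \<le> card T" by (intro card_inj_on_le) auto
  also have "card T = (q - 1) * (card N * (card N - 1))"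
    using assms(1) by (simp add: T_def card_cartesian_product card_distinct_pairs card_Diff_subset Compl_eq_Diff_UNIV)
  finally have le: "2 * card P \<le> (q - 1) * (card N * (card N - 1))" by (simp add: O2)
  have q: "q = 2 * card N + 1" using card_nonsquares[OF 2] assms(1) by (simp add: N_def)
  \<comment> \<open>This makes N nonempty, so the natural number subtraction
    \<open>card N - 1\<close> does not truncate.\<close>
  have "q > 1"
    using card_mono[of UNIV "{0, 1::'a}"] assms(1) by simp
  then have N: "real (card N - 1) = real (card N) - 1" using q by simp
  have "2 * real (card P) \<le> real (q - 1) * (real (card N) * real (card N - 1))"
    using le by (metis of_nat_le_iff of_nat_mult of_nat_numeral)
  \<comment> \<open>With n = \<open>card N\<close> and q = 2n + 1, both the halved bound and the
    claimed one equal n^2 (n - 1).\<close>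
  then show ?thesis
    unfolding P_def[symmetric] N q by (simp add: power2_eq_square algebra_simps)
qed

end
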